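(* Let $N\ge 1$ and $n_x\ge 1$ be integers, let $A_1,\dots,A_N\in\mathbb{R}^{n_x\times n_x}$, and consider the discrete-time switched linear system $x(k+1)=A_{\sigma(k)}x(k)$, $k\in\mathbb{N}$. Let $1\le\tau_{\min}\le\tau_{\max}<\infty$ be integers, $d=\tau_{\max}-\tau_{\min}+1$, let $L\ge 1$ be an integer, and let $M=N(N-1)^{L-1}d^{L}$. For $h\in\{1,\dots,M\}$ let $(i_{h,1},\dots,i_{h,L})$, $(\tau_{h,1},\dots,\tau_{h,L})$ denote the $h$-th $L$-switching-cycle and $T_h=\sum_{\ell=1}^{L}\tau_{h,\ell}$ its length. Then the following two statements are equivalent: (a) There exist matrix sequences $P_h:\{0,1,\dots,T_h\}\to\mathbb{S}^{n_x}_{\succ 0}$, $h\in\{1,\dots,M\}$, such that $$A_{i_{h,\ell}}^{\top}P_h(k+1)A_{i_{h,\ell}}-P_h(k)\prec 0$$ for all $h\in\{1,\dots,M\}$, all $\ell\in\{1,\dots,L\}$ and all integers $k$ with $\sum_{s=1}^{\ell-1}\tau_{h,s}\le k\le \sum_{s=1}^{\ell}\tau_{h,s}-1$ (that is, for every $k\in\{0,\dots,T_h-1\}$, with $i_{h,\ell}$ the subsystem active at step $k$ of the $h$-th cycle), and $$P_h(0)-P_q(T_q)\prec 0\quad\text{for all } h,q\in\{1,\dots,M\}.$$ (b) There exist matrices $P_h\in\mathbb{S}^{n_x}_{\succ 0}$, $h\in\{1,\dots,M\}$, such that $$\Phi_h^{\top}P_h\Phi_h-P_q\prec 0\quad\text{for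 all } h,q\in\{1,\dots,M\},$$ where $\Phi_h=\prod_{\ell=0}^{L-1}A_{i_{h,L-\ell}}^{\tau_{h,L-\ell}}=A_{i_{h,L}}^{\tau_{h,L}}A_{i_{h,L-1}}^{\tau_{h,L-1}}\cdots A_{i_{h,1}}^{\tau_{h,1}}$. Moreover, if one of (a), (b) holds, then the switched system is globally uniformly asymptotically stable (GUAS) under every switching signal $\sigma\in\mathcal{D}_{[\tau_{\min},\tau_{\max}]}$.
   Context: $\mathbb{N}=\{0,1,2,\dots\}$ is the set of natural numbers. $\mathbb{S}^{n}_{\succ 0}$ is the set of real symmetric positive definite $n\times n$ matrices; $X\succ Y$ (equivalently $Y\prec X$) means that $X-Y$ is symmetric positive definite. Switching signals: a switching signal is a function $\sigma:\mathbb{N}\to\{1,\dots,N\}$. Its switching sequence is $\{k_n\}_{n\in\mathbb{N}}$, where $k_0=0$ is the initial time and $k_1<k_2<\cdots$ are the discontinuity points of $\sigma$ (the times at which the value of $\sigma$ changes; $\sigma$ is constant on $\{k_n,\dots,k_{n+1}-1\}$ and $\sigma(k_{n+1})\ne\sigma(k_n)$). $\mathcal{D}_{[\tau_{\min},\tau_{\max}]}$ is the set of all switching signals for which $k_{n+1}-k_n\in[\tau_{\min},\tau_{\max}]$ for all $n\in\mathbb{N}$. $L$-switching-cycles: an $L$-switching-cycle is a pair consisting of a sequence of subsystem indices $(i_1,\dots,i_L)\in\{1,\dots,N\}^L$ with $i_\ell\ne i_{\ell+1}$ for $\ell\in\{1,\dots,L-1\}$ and a sequence of integer activation times $(\tau_1,\dots,\tau_L)$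 with each $\tau_\ell\in[\tau_{\min},\tau_{\max}]$ ($i_1$ is active for the first $\tau_1$ steps, then $i_2$ for $\tau_2$ steps, and so on). There are exactly $M=N(N-1)^{L-1}d^L$ such pairs, and $h\in\{1,\dots,M\}$ enumerates all of them. Class $\mathcal{K}$ and $\mathcal{KL}$: a continuous $\alpha:\mathbb{R}^+\to\mathbb{R}^+$ ($\mathbb{R}^+=[0,\infty)$) is of class $\mathcal{K}$ if it is strictly increasing and $\alpha(0)=0$. A function $\beta:\mathbb{R}^+\times\mathbb{R}^+\to\mathbb{R}^+$ is of class $\mathcal{KL}$ if $\beta(\cdot,s)$ is of class $\mathcal{K}$ for each fixed $s$ and, for each fixed $r$, $\beta(r,\cdot)$ is decreasing (in the non-strict sense) with $\beta(r,s)\to0$ as $s\to\infty$. GUAS: the equilibrium $x=0$ of the system is GUAS under the switching signal $\sigma$ if, for any initial condition $x(0)$, there exists a class $\mathcal{KL}$ function $\beta$ such that the solution satisfies $\|x(k)\|\le\beta(\|x(0)\|,k)$ for all $k\in\mathbb{N}$. *)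

theory Defs
  imports "HOL-Analysis.Analysis"
begin

section \<open>Matrices\<close>

definition pos_def :: "real^'n^'n \<Rightarrow> bool" where
  "pos_def X \<longleftrightarrow> transpose X = X \<and> (\<forall>v. v \<noteq> 0 \<longrightarrow> v \<bullet> (X *v v) > 0)"

definition prec :: "real^'n^'n \<Rightarrow> real^'n^'n \<Rightarrow> bool" (infix "\<prec>" 50) where
  "Y \<prec> X \<longleftrightarrow> pos_def (X - Y)"

text \<open>The library's operations \<open>*\<close> and \<open>^\<close> act componentwise on \<open>real^'n^'n\<close>, so powers
  with respect to the matrix product \<open>**\<close> are defined separately.\<close>

primrec mat_pow :: "real^'n^'n \<Rightarrow> nat \<Rightarrow> real^'n^'n" where
  "mat_pow X 0 = mat 1"
| "mat_pow X (Suc m) = X ** mat_pow X m"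

section \<open>Switching signals\<close>

definition switching_signal :: "nat \<Rightarrow> (nat \<Rightarrow> nat) \<Rightarrow> bool" where
  "switching_signal N \<sigma> \<longleftrightarrow> (\<forall>k. \<sigma> k \<in> {1..N})"

text \<open>\<open>ks\<close> starts at the initial time \<open>0\<close> and then lists, in increasing order, exactly the times
  at which the value of \<open>\<sigma>\<close> changes. Such a \<open>ks\<close> is unique, and it exists iff \<open>\<sigma>\<close> switches
  infinitely often.\<close>

definition switching_sequence :: "(nat \<Rightarrow> nat) \<Rightarrow> (nat \<Rightarrow> nat) \<Rightarrow> bool" where
  "switching_sequence \<sigma> ks \<longleftrightarrow>
     strict_mono ks \<and> ks 0 = 0 \<and> ks ` {1..} = {k. 1 \<le> k \<and> \<sigma> k \<noteq> \<sigma> (k - 1)}"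

definition dwell_signals :: "nat \<Rightarrow> nat \<Rightarrow> nat \<Rightarrow> (nat \<Rightarrow> nat) set" where
  "dwell_signals N \<tau>min \<tau>max =
     {\<sigma>. switching_signal N \<sigma> \<and>
        (\<exists>ks. switching_sequence \<sigma> ks \<and> (\<forall>n. ks (Suc n) - ks n \<in> {\<tau>min..\<tau>max}))}"

section \<open>Switching cycles\<close>

text \<open>A cycle is a pair of a sequence of subsystem indices and a sequence of activation times, both
  indexed by \<open>{1..L}\<close> and extensional, so that distinct elements are distinct cycles.\<close>

type_synonym cycle = "(nat \<Rightarrow> nat) \<times> (nat \<Rightarrow> nat)"

definition index_seqs :: "nat \<Rightarrow> nat \<Rightarrow> (nat \<Rightarrow> nat) set" where
  "index_seqs N L = {i \<in> {1..L} \<rightarrow>\<^sub>E {1..N}. \<forall>l\<in>{1..L - 1}. i l \<noteq> i (l + 1)}"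

definition switching_cycles :: "nat \<Rightarrow> nat \<Rightarrow> nat \<Rightarrow> nat \<Rightarrow> cycle set" where
  "switching_cycles N \<tau>min \<tau>max L = index_seqs N L \<times> ({1..L} \<rightarrow>\<^sub>E {\<tau>min..\<tau>max})"

abbreviation subsys :: "cycle \<Rightarrow> nat \<Rightarrow> nat" where
  "subsys c l \<equiv> fst c l"

abbreviation actime :: "cycle \<Rightarrow> nat \<Rightarrow> nat" where
  "actime c l \<equiv> snd c l"

definition cycle_length :: "nat \<Rightarrow> cycle \<Rightarrow> nat" where
  "cycle_length L c = (\<Sum>l = 1..L. actime c l)"

primrec cycle_matrix :: "(nat \<Rightarrow> real^'n^'n) \<Rightarrow> cycle \<Rightarrow> nat \<Rightarrow> real^'n^'n" where
  "cycle_matrix A c 0 = mat 1"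
| "cycle_matrix A c (Suc l) =
     mat_pow (A (subsys c (Suc l))) (actime c (Suc l)) ** cycle_matrix A c l"

definition num_cycles :: "nat \<Rightarrow> nat \<Rightarrow> nat \<Rightarrow> nat \<Rightarrow> nat" where
  "num_cycles N \<tau>min \<tau>max L = N * (N - 1) ^ (L - 1) * (\<tau>max - \<tau>min + 1) ^ L"

lemma index_seqs_Suc:
  assumes "1 \<le> L"
  shows "bij_betw (\<lambda>(i, j). i(Suc L := j))
           (SIGMA i:index_seqs N L. {1..N} - {i L}) (index_seqs N (Suc L))"
proof (rule bij_betw_byWitness[where f' = "\<lambda>i. (i(Suc L := undefined), i (Suc L))"])
  let ?S = "SIGMA i:index_seqs N L. {1..N} - {i L}"
  show "\<forall>a\<in>?S. (\<lambda>i. (i(Suc L := undefined), i (Suc L))) ((\<lambda>(i, j). i(Suc L := j)) a) = a"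
    by (auto simp: index_seqs_def PiE_def extensional_def fun_eq_iff)
  show "\<forall>a\<in>index_seqs N (Suc L).
          (\<lambda>(i, j). i(Suc L := j)) ((\<lambda>i. (i(Suc L := undefined), i (Suc L))) a) = a"
    by simp
  show "(\<lambda>(i, j). i(Suc L := j)) ` ?S \<subseteq> index_seqs N (Suc L)"
    by (auto simp: index_seqs_def PiE_def Pi_def extensional_def le_Suc_eq split: if_splits)
  show "(\<lambda>i. (i(Suc L := undefined), i (Suc L))) ` index_seqs N (Suc L) \<subseteq> ?S"
  proof
    fix p assume "p \<in> (\<lambda>i. (i(Suc L := undefined), i (Suc L))) ` index_seqs N (Suc L)"
    then obtain i where p: "p = (i(Suc L := undefined), i (Suc L))"
      and i: "i \<in> {1..Suc L} \<rightarrow>\<^sub>E {1..N}" and ne: "\<forall>l\<in>{1..L}. i l \<noteq> i (l + 1)"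
      by (auto simp: index_seqs_def)
    have "i(Suc L := undefined) \<in> {1..L} \<rightarrow>\<^sub>E {1..N}"
      using i by (auto simp: PiE_iff extensional_def)
    moreover have "\<forall>l\<in>{1..L - 1}. (i(Suc L := undefined)) l \<noteq> (i(Suc L := undefined)) (l + 1)"
      using ne by auto
    moreover have "i (Suc L) \<in> {1..N}"
      using i by (simp add: PiE_iff)
    moreover have "i L \<noteq> i (Suc L)"
      using bspec[OF ne, of L] assms by simp
    ultimately show "p \<in> ?S"
      using p by (simp add: index_seqs_def)
  qed
qed

lemma finite_index_seqs: "finite (index_seqs N L)"
  by (simp add: index_seqs_def finite_PiE)

lemma card_index_seqs:
  assumes "1 \<le> L"
  shows "card (index_seqs N L) = N * (N - 1) ^ (L - 1)"
  using assms
proof (induction L rule: nat_induct_at_least)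
  case base
  have "index_seqs N 1 = {1..1} \<rightarrow>\<^sub>E {1..N}" by (auto simp: index_seqs_def)
  then show ?case by (simp add: card_PiE)
next
  case (Suc L)
  have mem: "i L \<in> {1..N}" if "i \<in> index_seqs N L" for i
    using that Suc.hyps by (auto simp: index_seqs_def PiE_def Pi_def)
  have "card (index_seqs N (Suc L)) = card (SIGMA i:index_seqs N L. {1..N} - {i L})"
    using bij_betw_same_card[OF index_seqs_Suc[OF Suc.hyps]] by metis
  also have "\<dots> = (\<Sum>i\<in>index_seqs N L. card ({1..N} - {i L}))"
    by (simp add: card_SigmaI finite_index_seqs)
  also have "\<dots> = (\<Sum>i\<in>index_seqs N L. N - 1)"
    using mem by (intro sum.cong) (simp_all add: card_Diff_singleton)
  also have "\<dots> = N * (N - 1) ^ (Suc L - 1)"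
    using Suc by (cases L) simp_all
  finally show ?case .
qed

text \<open>The enumeration of the cycles by \<open>{1..M}\<close> that the theorem fixes does exist.\<close>

lemma card_switching_cycles:
  assumes "1 \<le> L" "\<tau>min \<le> \<tau>max"
  shows "finite (switching_cycles N \<tau>min \<tau>max L)"
    and "card (switching_cycles N \<tau>min \<tau>max L) = num_cycles N \<tau>min \<tau>max L"
  using assms
  by (simp_all add: switching_cycles_def num_cycles_def card_cartesian_product card_index_seqs
      card_PiE finite_PiE finite_index_seqs Suc_diff_le)

lemma cycle_enumeration_exists:
  assumes "1 \<le> L" "\<tau>min \<le> \<tau>max"
  shows "\<exists>cyc. bij_betw cyc {1..num_cycles N \<tau>min \<tau>max L} (switching_cycles N \<tau>min \<tau>max L)"
  using card_switching_cycles[OF assms, of N] by (intro finite_same_card_bij) auto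

section \<open>The two families of matrix inequalities\<close>

definition sequence_condition ::
  "(nat \<Rightarrow> real^'n^'n) \<Rightarrow> nat \<Rightarrow> nat \<Rightarrow> (nat \<Rightarrow> cycle) \<Rightarrow> bool" where
  "sequence_condition A L M cyc \<longleftrightarrow>
     (\<exists>P :: nat \<Rightarrow> nat \<Rightarrow> real^'n^'n.
        (\<forall>h\<in>{1..M}. \<forall>k\<in>{0..cycle_length L (cyc h)}. pos_def (P h k)) \<and>
        (\<forall>h\<in>{1..M}. \<forall>l\<in>{1..L}. \<forall>k.
           (\<Sum>s = 1..l - 1. actime (cyc h) s) \<le> k \<and> k < (\<Sum>s = 1..l. actime (cyc h) s) \<longrightarrow>
           transpose (A (subsys (cyc h) l)) ** P h (k + 1) ** A (subsys (cyc h) l) - P h k \<prec> 0) \<and>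
        (\<forall>h\<in>{1..M}. \<forall>q\<in>{1..M}. P h 0 - P q (cycle_length L (cyc q)) \<prec> 0))"

definition lifted_condition ::
  "(nat \<Rightarrow> real^'n^'n) \<Rightarrow> nat \<Rightarrow> nat \<Rightarrow> (nat \<Rightarrow> cycle) \<Rightarrow> bool" where
  "lifted_condition A L M cyc \<longleftrightarrow>
     (\<exists>P :: nat \<Rightarrow> real^'n^'n.
        (\<forall>h\<in>{1..M}. pos_def (P h)) \<and>
        (\<forall>h\<in>{1..M}. \<forall>q\<in>{1..M}.
           transpose (cycle_matrix A (cyc h) L) ** P h ** cycle_matrix A (cyc h) L - P q \<prec> 0))"

section \<open>Stability\<close>

primrec solution :: "(nat \<Rightarrow> real^'n^'n) \<Rightarrow> (nat \<Rightarrow> nat) \<Rightarrow> real^'n \<Rightarrow> nat \<Rightarrow> real^'n" where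
  "solution A \<sigma> x0 0 = x0"
| "solution A \<sigma> x0 (Suc k) = A (\<sigma> k) *v solution A \<sigma> x0 k"

definition class_K :: "(real \<Rightarrow> real) \<Rightarrow> bool" where
  "class_K \<alpha> \<longleftrightarrow> \<alpha> \<in> {0..} \<rightarrow> {0..} \<and> continuous_on {0..} \<alpha> \<and> strict_mono_on {0..} \<alpha> \<and> \<alpha> 0 = 0"

definition class_KL :: "(real \<Rightarrow> real \<Rightarrow> real) \<Rightarrow> bool" where
  "class_KL \<beta> \<longleftrightarrow>
     (\<forall>s\<ge>0. class_K (\<lambda>r. \<beta> r s)) \<and>
     (\<forall>r\<ge>0. antimono_on {0..} (\<beta> r) \<and> (\<beta> r \<longlongrightarrow> 0) at_top)"

text \<open>The comparison function may depend on the initial condition, not only on its norm.\<close>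

definition GUAS :: "(nat \<Rightarrow> real^'n^'n) \<Rightarrow> (nat \<Rightarrow> nat) \<Rightarrow> bool" where
  "GUAS A \<sigma> \<longleftrightarrow>
     (\<forall>x0. \<exists>\<beta>. class_KL \<beta> \<and> (\<forall>k. norm (solution A \<sigma> x0 k) \<le> \<beta> (norm x0) (real k)))"

end

theory Submission
  imports Defs "HOL-Real_Asymp.Real_Asymp"
begin

text \<open>Everything is read as inequalities between quadratic forms \<open>v \<bullet> (X *v v)\<close>: for the product
  \<open>\<Phi>\<close> of the matrices of a cycle, the lifted condition says that the form of \<open>P\<^sub>h\<close> at
  \<open>\<Phi>\<^sub>h v\<close> is less than every form \<open>P\<^sub>q\<close> at \<open>v \<noteq> 0\<close>.

  Along a sequence as in the sequence condition the form at time \<open>k\<close>, evaluated on the trajectory,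
  does not increase; hence the terminal matrices \<open>P\<^sub>h(T\<^sub>h)\<close> solve the lifted condition, the strictness
  coming from the jump inequality (\<open>sequence_condition_imp_lifted\<close>). Conversely, a sequence ending
  in \<open>P\<^sub>h\<close> is obtained by pulling \<open>P\<^sub>h\<close> back through the cycle, adding a small multiple of the
  identity at each step to make the decrease strict; without these additions the pulled back
  matrix at time \<open>0\<close> would be \<open>\<Phi>\<^sub>h\<^sup>T P\<^sub>h \<Phi>\<^sub>h\<close>, which lies strictly below
  all \<open>P\<^sub>q\<close>, so sufficiently small additions keep it there (\<open>decreasing_sequence_exists\<close>).

  For stability, cut an admissible signal into consecutive groups of \<open>L\<close> activation periods. Each
  group is an \<open>L\<close>-switching-cycle, and since the lifted condition allows an arbitrary pair of cycles,
  passing from one group to the next contracts the form of the last completed cycle, by a factor that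
  can be chosen uniformly because the cycles are finitely many (\<open>lifted_condition_contraction\<close>).
  The group lengths are bounded by \<open>L \<tau>\<^sub>m\<^sub>a\<^sub>x\<close>, so this decay at the group boundaries
  yields an exponential estimate at all times (\<open>GUAS_of_sampled_decay\<close>).\<close>

section \<open>Quadratic forms\<close>

definition quad :: "real^'n^'n \<Rightarrow> real^'n \<Rightarrow> real" where
  "quad X v = v \<bullet> (X *v v)"

lemma quad_diff: "quad (X - Y) v = quad X v - quad Y v"
  by (simp add: quad_def matrix_vector_mult_diff_rdistrib inner_diff_right)

lemma quad_add: "quad (X + Y) v = quad X v + quad Y v"
  by (simp add: quad_def matrix_vector_mult_add_rdistrib inner_add_right)

lemma quad_scaleR: "quad (e *\<^sub>R X) v = e * quad X v"
  by (simp add: quad_def scaleR_matrix_vector_assoc[symmetric])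

lemma quad_scaled_vector: "quad X (t *\<^sub>R v) = t\<^sup>2 * quad X v"
  by (simp add: quad_def matrix_vector_mult_scaleR power2_eq_square)

lemma quad_one: "quad (mat 1) v = (norm v)\<^sup>2"
  by (simp add: quad_def power2_norm_eq_inner)

lemma quad_zero: "quad X 0 = 0"
  by (simp add: quad_def)

lemma quad_congruence: "quad (transpose F ** X ** F) v = quad X (F *v v)"
proof -
  have "(transpose F ** X ** F) *v v = transpose F *v (X *v (F *v v))"
    by (simp add: matrix_vector_mul_assoc matrix_mul_assoc)
  then show ?thesis
    unfolding quad_def transpose_matrix_vector by (metis dot_lmul_matrix inner_commute)
qed

lemma continuous_on_quad: "continuous_on S (quad X)"
  unfolding quad_def by (intro continuous_intros linear_continuous_on_compose[OF continuous_on_id]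
      matrix_vector_mul_linear)

lemma transpose_diff: "transpose (X - Y) = transpose X - transpose (Y :: real^'n^'m)"
  by (simp add: transpose_def vec_eq_iff)

lemma transpose_add: "transpose (X + Y) = transpose X + transpose (Y :: real^'n^'m)"
  by (simp add: transpose_def vec_eq_iff)

lemma transpose_congruence:
  "transpose X = X \<Longrightarrow> transpose (transpose F ** X ** F) = transpose F ** X ** (F :: real^'n^'m)"
  by (simp add: matrix_transpose_mul matrix_mul_assoc)

lemma pos_def_quad: "pos_def X \<longleftrightarrow> transpose X = X \<and> (\<forall>v. v \<noteq> 0 \<longrightarrow> quad X v > 0)"
  by (simp add: pos_def_def quad_def)

lemma pos_def_sym: "pos_def X \<Longrightarrow> transpose X = X"
  by (simp add: pos_def_def)

lemma diff_prec_zero_iff: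
  assumes "transpose X = X" "transpose Y = Y"
  shows "X - Y \<prec> 0 \<longleftrightarrow> (\<forall>v. v \<noteq> 0 \<longrightarrow> quad X v < quad Y v)"
  using assms by (simp add: prec_def pos_def_quad transpose_diff quad_diff)

lemma congruence_prec_zero_iff:
  assumes "pos_def X" "pos_def Y"
  shows "transpose F ** X ** F - Y \<prec> 0 \<longleftrightarrow> (\<forall>v. v \<noteq> 0 \<longrightarrow> quad X (F *v v) < quad Y v)"
  unfolding diff_prec_zero_iff[OF transpose_congruence[OF pos_def_sym[OF assms(1)]]
      pos_def_sym[OF assms(2)]] quad_congruence ..

lemma pos_def_mat_1: "pos_def (mat 1)"
  by (simp add: pos_def_quad quad_one)

lemma quad_nonneg: "pos_def X \<Longrightarrow> 0 \<le> quad X v"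
  by (cases "v = 0") (auto simp: pos_def_quad quad_zero less_imp_le)

text \<open>The small constants of the proof all come from this openness property. On the unit sphere, which is
  compact, the form of \<open>X\<close> has a positive minimum and the form of \<open>S\<close> is bounded above, and both
  forms are homogeneous of degree two. Stating it as an eventual property for \<open>e \<rightarrow> 0\<close> makes one
  \<open>e\<close> available for finitely many inequalities at once.\<close>

lemma pos_def_perturb:
  fixes X S :: "real^'n^'n"
  assumes "pos_def X" "transpose S = S"
  shows "\<forall>\<^sub>F e in at_right 0. pos_def (X - e *\<^sub>R S)"
proof -
  obtain u where u: "u \<in> sphere 0 1" and min: "\<And>v. v \<in> sphere 0 1 \<Longrightarrow> quad X u \<le> quad X v"
    using continuous_attains_inf[OF compact_sphere _ continuous_on_quad, of 0 1 X] by auto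
  obtain w where "w \<in> sphere 0 1" and max: "\<And>v. v \<in> sphere 0 1 \<Longrightarrow> quad S v \<le> quad S w"
    using continuous_attains_sup[OF compact_sphere _ continuous_on_quad, of 0 1 S] by auto
  define m where "m = quad X u"
  define B where "B = \<bar>quad S w\<bar> + 1"
  have "u \<noteq> 0"
    using u by auto
  then have m: "m > 0"
    using assms(1) by (simp add: m_def pos_def_quad)
  have B: "B > 0"
    by (simp add: B_def)
  have "pos_def (X - e *\<^sub>R S)" if e: "0 < e" "e < m / B" for e
    unfolding pos_def_quad
  proof (intro conjI allI impI)
    show "transpose (X - e *\<^sub>R S) = X - e *\<^sub>R S"
      using assms by (simp add: transpose_diff transpose_scalar pos_def_sym)
    fix v :: "real^'n" assume v: "v \<noteq> 0"
    define y where "y = (1 / norm v) *\<^sub>R v"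
    have y: "y \<in> sphere 0 1" and vy: "v = norm v *\<^sub>R y"
      using v by (auto simp: y_def)
    have "e * quad S y \<le> e * B"
      using max[OF y] e by (intro mult_left_mono) (auto simp: B_def)
    also have "\<dots> < m"
      using e B by (simp add: field_simps)
    also have "m \<le> quad X y"
      using min[OF y] by (simp add: m_def)
    finally have "0 < quad (X - e *\<^sub>R S) y"
      by (simp add: quad_diff quad_scaleR)
    then have "0 < quad (X - e *\<^sub>R S) (norm v *\<^sub>R y)"
      unfolding quad_scaled_vector using v by (intro mult_pos_pos) auto
    then show "0 < quad (X - e *\<^sub>R S) v"
      using vy by simp
  qed
  then show ?thesis
    using m B unfolding eventually_at_right_field by (intro exI[of _ "m / B"]) auto
qed

section \<open>Transition matrices of time-varying systems\<close>

primrec transition :: "(nat \<Rightarrow> real^'n^'n) \<Rightarrow> nat \<Rightarrow> real^'n^'n" where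
  "transition a 0 = mat 1"
| "transition a (Suc k) = a k ** transition a k"

lemma transition_const_block:
  assumes "\<And>k. m \<le> k \<Longrightarrow> k < m + t \<Longrightarrow> a k = X"
  shows "transition a (m + t) = mat_pow X t ** transition a m"
  using assms by (induction t) (simp_all add: matrix_mul_assoc)

text \<open>The modes \<open>a\<close> are left abstract because the cycle product is needed both for the modes
  listed by the cycle itself and for the tail of a switching signal that runs through the cycle.\<close>

lemma transition_cycle:
  assumes "\<And>l k. l \<in> {1..L} \<Longrightarrow> (\<Sum>s = 1..l - 1. actime c s) \<le> k \<Longrightarrow>
             k < (\<Sum>s = 1..l. actime c s) \<Longrightarrow> a k = A (subsys c l)"
    and "l \<le> L"
  shows "transition a (\<Sum>s = 1..l. actime c s) = cycle_matrix A c l"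
  using assms(2)
proof (induction l)
  case (Suc l)
  have "transition a ((\<Sum>s = 1..l. actime c s) + actime c (Suc l))
      = mat_pow (A (subsys c (Suc l))) (actime c (Suc l)) ** transition a (\<Sum>s = 1..l. actime c s)"
    using Suc.prems by (intro transition_const_block assms(1)) auto
  then show ?case
    using Suc by simp
qed simp

text \<open>Meaningful only for steps \<open>k\<close> below the length of the cycle.\<close>

definition active_block :: "cycle \<Rightarrow> nat \<Rightarrow> nat" where
  "active_block c k = (LEAST l. k < (\<Sum>s = 1..l. actime c s))"

lemma active_block_eq:
  assumes "1 \<le> l" "(\<Sum>s = 1..l - 1. actime c s) \<le> k" "k < (\<Sum>s = 1..l. actime c s)"
  shows "active_block c k = l"
  unfolding active_block_def
proof (rule Least_equality)
  fix j assume j: "k < (\<Sum>s = 1..j. actime c s)"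
  show "l \<le> j"
  proof (rule ccontr)
    assume "\<not> l \<le> j"
    then have "(\<Sum>s = 1..j. actime c s) \<le> (\<Sum>s = 1..l - 1. actime c s)"
      by (intro sum_mono2) auto
    with j assms show False by simp
  qed
qed (fact assms(3))

lemma active_block_bounds:
  assumes "k < cycle_length L c"
  shows "active_block c k \<in> {1..L}"
    and "(\<Sum>s = 1..active_block c k - 1. actime c s) \<le> k"
    and "k < (\<Sum>s = 1..active_block c k. actime c s)"
proof -
  have L: "k < (\<Sum>s = 1..L. actime c s)"
    using assms by (simp add: cycle_length_def)
  show 3: "k < (\<Sum>s = 1..active_block c k. actime c s)"
    unfolding active_block_def by (rule LeastI, rule L)
  have ne: "active_block c k \<noteq> 0"
    using 3 by (intro notI) simp
  moreover have "active_block c k \<le> L"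
    unfolding active_block_def by (rule Least_le, rule L)
  ultimately show "active_block c k \<in> {1..L}" by simp
  show "(\<Sum>s = 1..active_block c k - 1. actime c s) \<le> k"
    using not_less_Least[of "active_block c k - 1" "\<lambda>l. k < (\<Sum>s = 1..l. actime c s)"] ne
    by (fold active_block_def) simp
qed

abbreviation cycle_modes :: "(nat \<Rightarrow> real^'n^'n) \<Rightarrow> cycle \<Rightarrow> nat \<Rightarrow> real^'n^'n" where
  "cycle_modes A c k \<equiv> A (subsys c (active_block c k))"

lemma transition_cycle_modes:
  "transition (cycle_modes A c) (cycle_length L c) = cycle_matrix A c L"
  unfolding cycle_length_def
proof (rule transition_cycle[where L = L])
  fix l k
  assume "l \<in> {1..L}" "(\<Sum>s = 1..l - 1. actime c s) \<le> k" "k < (\<Sum>s = 1..l. actime c s)"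
  then have "active_block c k = l"
    by (intro active_block_eq) auto
  then show "cycle_modes A c k = A (subsys c l)"
    by simp
qed simp

section \<open>Equivalence of the two conditions\<close>

text \<open>The forms decrease along a nonzero trajectory at every step. After the trajectory has reached
  \<open>0\<close> the matrix inequality says nothing, but then both values are \<open>0\<close>.\<close>

lemma quad_transition_le:
  assumes pd: "\<And>k. k \<le> T \<Longrightarrow> pos_def (P k)"
    and dec: "\<And>k. k < T \<Longrightarrow> transpose (a k) ** P (k + 1) ** a k - P k \<prec> 0"
    and "k \<le> T"
  shows "quad (P k) (transition a k *v v) \<le> quad (P 0) v"
  using assms(3)
proof (induction k)
  case (Suc k)
  define w where "w = transition a k *v v"
  have "quad (P (Suc k)) (a k *v w) \<le> quad (P k) w"
    using congruence_prec_zero_iff[of "P (Suc k)" "P k" "a k"] dec[of k] pd[of k] pd[of "Suc k"] Suc.prems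
    by (cases "w = 0") (auto simp: quad_zero less_imp_le)
  also have "\<dots> \<le> quad (P 0) v"
    using Suc by (simp add: w_def)
  finally show ?case
    by (simp add: w_def matrix_vector_mul_assoc)
qed simp

text \<open>The strict inequalities at time \<open>0\<close> leave room to make every step of
  the backward recursion \<open>P k = a\<^sub>k\<^sup>T P\<^sub>k\<^sub>+\<^sub>1 a\<^sub>k + e I\<close> strict. Peeling off the last
  step lets each step use its own \<open>e\<close>, chosen so small that the hypothesis survives for the new
  terminal matrix.\<close>

lemma decreasing_sequence_exists:
  fixes a :: "nat \<Rightarrow> real^'n^'n"
  assumes "finite \<R>" "\<And>R. R \<in> \<R> \<Longrightarrow> pos_def R"
    and "pos_def Q"
    and "\<And>R. R \<in> \<R> \<Longrightarrow> transpose (transition a T) ** Q ** transition a T - R \<prec> 0"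
  shows "\<exists>P. P T = Q \<and> (\<forall>k\<le>T. pos_def (P k)) \<and>
           (\<forall>k<T. transpose (a k) ** P (k + 1) ** a k - P k \<prec> 0) \<and> (\<forall>R\<in>\<R>. P 0 - R \<prec> 0)"
  using assms(3,4)
proof (induction T arbitrary: Q)
  case 0
  then show ?case
    by (intro exI[of _ "\<lambda>_. Q"]) (simp add: transpose_mat)
next
  case (Suc T)
  define F where "F = transition a T"
  define Q' where "Q' e = transpose (a T) ** Q ** a T + e *\<^sub>R mat 1" for e :: real
  have Q': "pos_def (Q' e)" if "e > 0" for e
    using that Suc.prems(1) quad_nonneg[OF Suc.prems(1)] unfolding pos_def_quad Q'_def
    by (auto simp: transpose_add transpose_scalar transpose_mat transpose_congruence quad_add
        quad_scaleR quad_congruence quad_one intro!: add_nonneg_pos)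
  have "\<forall>\<^sub>F e in at_right 0. \<forall>R\<in>\<R>. pos_def
      (R - transpose (transition a (Suc T)) ** Q ** transition a (Suc T)
         - e *\<^sub>R (transpose F ** mat 1 ** F))"
    using Suc.prems assms(1)
    by (intro eventually_ball_finite ballI pos_def_perturb)
      (auto simp: prec_def matrix_transpose_mul)
  moreover have "\<forall>\<^sub>F e in at_right (0::real). e > 0"
    by (simp add: eventually_at_right_less)
  ultimately have "\<forall>\<^sub>F e in at_right 0. e > 0 \<and> (\<forall>R\<in>\<R>. pos_def
      (R - transpose (transition a (Suc T)) ** Q ** transition a (Suc T)
         - e *\<^sub>R (transpose F ** mat 1 ** F)))"
    by (simp add: eventually_conj)
  then obtain e :: real where e: "e > 0" and R: "\<And>R. R \<in> \<R> \<Longrightarrow> pos_def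
      (R - transpose (transition a (Suc T)) ** Q ** transition a (Suc T)
         - e *\<^sub>R (transpose F ** mat 1 ** F))"
    using eventually_happens'[OF trivial_limit_at_right_real] by blast
  have "transpose F ** Q' e ** F - R \<prec> 0" if "R \<in> \<R>" for R
    unfolding congruence_prec_zero_iff[OF Q'[OF e] assms(2)[OF that]]
  proof (intro allI impI)
    fix v :: "real^'n" assume "v \<noteq> 0"
    then have "0 < quad (R - transpose (transition a (Suc T)) ** Q ** transition a (Suc T)
         - e *\<^sub>R (transpose F ** mat 1 ** F)) v"
      using R[OF that] unfolding pos_def_quad by blast
    then show "quad (Q' e) (F *v v) < quad R v"
      unfolding quad_diff quad_scaleR quad_congruence
      by (simp add: Q'_def F_def quad_add quad_scaleR quad_congruence matrix_vector_mul_assoc)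
  qed
  then obtain P where P: "P T = Q' e" "\<And>k. k \<le> T \<Longrightarrow> pos_def (P k)"
      "\<And>k. k < T \<Longrightarrow> transpose (a k) ** P (k + 1) ** a k - P k \<prec> 0" "\<And>R. R \<in> \<R> \<Longrightarrow> P 0 - R \<prec> 0"
    using Suc.IH[OF Q'[OF e]] unfolding F_def by blast
  have last: "transpose (a T) ** Q ** a T - Q' e \<prec> 0"
    using e by (simp add: Q'_def prec_def pos_def_quad transpose_scalar transpose_mat quad_scaleR quad_one)
  show ?case
    using P last Suc.prems(1)
    by (intro exI[of _ "P(Suc T := Q)"]) (auto simp: less_Suc_eq le_Suc_eq)
qed

lemma sequence_condition_imp_lifted:
  fixes A :: "nat \<Rightarrow> real^'n^'n"
  assumes "sequence_condition A L M cyc"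
  shows "lifted_condition A L M cyc"
proof -
  obtain P :: "nat \<Rightarrow> nat \<Rightarrow> real^'n^'n"
    where pd: "\<And>h k. h \<in> {1..M} \<Longrightarrow> k \<in> {0..cycle_length L (cyc h)} \<Longrightarrow> pos_def (P h k)"
    and dec: "\<And>h l k. h \<in> {1..M} \<Longrightarrow> l \<in> {1..L} \<Longrightarrow> (\<Sum>s = 1..l - 1. actime (cyc h) s) \<le> k \<Longrightarrow>
        k < (\<Sum>s = 1..l. actime (cyc h) s) \<Longrightarrow>
        transpose (A (subsys (cyc h) l)) ** P h (k + 1) ** A (subsys (cyc h) l) - P h k \<prec> 0"
    and jump: "\<And>h q. h \<in> {1..M} \<Longrightarrow> q \<in> {1..M} \<Longrightarrow> P h 0 - P q (cycle_length L (cyc q)) \<prec> 0"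
    using assms unfolding sequence_condition_def by blast
  define R where "R h = P h (cycle_length L (cyc h))" for h
  have R: "pos_def (R h)" if "h \<in> {1..M}" for h
    using pd that by (simp add: R_def)
  have "transpose (cycle_matrix A (cyc h) L) ** R h ** cycle_matrix A (cyc h) L - R q \<prec> 0"
    if h: "h \<in> {1..M}" and q: "q \<in> {1..M}" for h q
    unfolding congruence_prec_zero_iff[OF R[OF h] R[OF q]]
  proof (intro allI impI)
    fix v :: "real^'n" assume v: "v \<noteq> 0"
    have "quad (R h) (cycle_matrix A (cyc h) L *v v) \<le> quad (P h 0) v"
      unfolding R_def transition_cycle_modes[symmetric]
      by (rule quad_transition_le[where T = "cycle_length L (cyc h)"])
        (use h pd dec active_block_bounds in auto)
    also have "quad (P h 0) v < quad (R q) v"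
      using jump[OF h q] diff_prec_zero_iff[of "P h 0" "R q"] v pd[OF h, of 0] R[OF q]
      by (simp add: R_def pos_def_sym)
    finally show "quad (R h) (cycle_matrix A (cyc h) L *v v) < quad (R q) v" .
  qed
  then show ?thesis
    unfolding lifted_condition_def using R by blast
qed

lemma lifted_condition_imp_sequence:
  fixes A :: "nat \<Rightarrow> real^'n^'n"
  assumes "lifted_condition A L M cyc"
  shows "sequence_condition A L M cyc"
proof -
  obtain P :: "nat \<Rightarrow> real^'n^'n" where pd: "\<And>h. h \<in> {1..M} \<Longrightarrow> pos_def (P h)"
    and step: "\<And>h q. h \<in> {1..M} \<Longrightarrow> q \<in> {1..M} \<Longrightarrow>
        transpose (cycle_matrix A (cyc h) L) ** P h ** cycle_matrix A (cyc h) L - P q \<prec> 0"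
    using assms unfolding lifted_condition_def by blast
  have "\<exists>p. p (cycle_length L (cyc h)) = P h \<and> (\<forall>k\<le>cycle_length L (cyc h). pos_def (p k)) \<and>
      (\<forall>k<cycle_length L (cyc h). transpose (cycle_modes A (cyc h) k) ** p (k + 1) **
         cycle_modes A (cyc h) k - p k \<prec> 0) \<and> (\<forall>R\<in>P ` {1..M}. p 0 - R \<prec> 0)"
    if "h \<in> {1..M}" for h
    by (rule decreasing_sequence_exists) (use that pd step in \<open>auto simp: transition_cycle_modes\<close>)
  then obtain p :: "nat \<Rightarrow> nat \<Rightarrow> real^'n^'n"
    where p: "\<And>h. h \<in> {1..M} \<Longrightarrow> p h (cycle_length L (cyc h)) = P h"
    and p_pd: "\<And>h k. h \<in> {1..M} \<Longrightarrow> k \<le> cycle_length L (cyc h) \<Longrightarrow> pos_def (p h k)"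
    and p_dec: "\<And>h k. h \<in> {1..M} \<Longrightarrow> k < cycle_length L (cyc h) \<Longrightarrow>
      transpose (cycle_modes A (cyc h) k) ** p h (k + 1) ** cycle_modes A (cyc h) k - p h k \<prec> 0"
    and p_jump: "\<And>h q. h \<in> {1..M} \<Longrightarrow> q \<in> {1..M} \<Longrightarrow> p h 0 - P q \<prec> 0"
    by (metis imageI)
  have "transpose (A (subsys (cyc h) l)) ** p h (k + 1) ** A (subsys (cyc h) l) - p h k \<prec> 0"
    if h: "h \<in> {1..M}" and l: "l \<in> {1..L}" and k: "(\<Sum>s = 1..l - 1. actime (cyc h) s) \<le> k"
      "k < (\<Sum>s = 1..l. actime (cyc h) s)" for h l k
  proof -
    have "(\<Sum>s = 1..l. actime (cyc h) s) \<le> cycle_length L (cyc h)"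
      unfolding cycle_length_def using l by (intro sum_mono2) auto
    then show ?thesis
      using p_dec[OF h, of k] active_block_eq[of l "cyc h" k] k l by simp
  qed
  then show ?thesis
    unfolding sequence_condition_def using p p_pd p_jump
    by (intro exI[of _ p]) auto
qed

section \<open>Decomposition of a switching signal into cycles\<close>

lemma switching_sequence_const:
  assumes "switching_sequence \<sigma> ks" "ks n \<le> k" "k < ks (Suc n)"
  shows "\<sigma> k = \<sigma> (ks n)"
  using assms(2,3)
proof (induction k rule: dec_induct)
  case (step k)
  have mono: "strict_mono ks"
    and img: "ks ` {1..} = {k. 1 \<le> k \<and> \<sigma> k \<noteq> \<sigma> (k - 1)}"
    using assms(1) by (auto simp: switching_sequence_def)
  have "\<sigma> (Suc k) = \<sigma> k"
  proof (rule ccontr)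
    assume "\<sigma> (Suc k) \<noteq> \<sigma> k"
    then have "Suc k \<in> ks ` {1..}"
      unfolding img by simp
    then obtain m where m: "Suc k = ks m" by auto
    then have "ks n < ks m" "ks m < ks (Suc n)"
      using step by auto
    then show False
      using mono by (simp add: strict_mono_less)
  qed
  then show ?case
    using step by simp
qed simp

text \<open>The \<open>j\<close>-th group of \<open>L\<close> consecutive activation periods of \<open>\<sigma>\<close>. Its entry
  \<open>l \<in> {1..L}\<close> is the period that starts at switching time number \<open>j * L + l - 1\<close>.\<close>

definition signal_cycle :: "(nat \<Rightarrow> nat) \<Rightarrow> (nat \<Rightarrow> nat) \<Rightarrow> nat \<Rightarrow> nat \<Rightarrow> cycle" where
  "signal_cycle \<sigma> ks L j =
     (restrict (\<lambda>l. \<sigma> (ks (j * L + l - 1))) {1..L},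
      restrict (\<lambda>l. ks (j * L + l) - ks (j * L + l - 1)) {1..L})"

lemma signal_cycle_mem:
  assumes sw: "switching_signal N \<sigma>" and ks: "switching_sequence \<sigma> ks"
    and dwell: "\<And>n. ks (Suc n) - ks n \<in> {\<tau>min..\<tau>max}"
  shows "signal_cycle \<sigma> ks L j \<in> switching_cycles N \<tau>min \<tau>max L"
proof -
  have change: "\<sigma> (ks n) \<noteq> \<sigma> (ks (Suc n))" for n
  proof -
    have mono: "strict_mono ks"
      and img: "ks ` {1..} = {k. 1 \<le> k \<and> \<sigma> k \<noteq> \<sigma> (k - 1)}"
      using ks by (auto simp: switching_sequence_def)
    have lt: "ks n < ks (Suc n)"
      using mono by (simp add: strict_mono_less)
    have "ks (Suc n) \<in> ks ` {1..}" by simp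
    then have "\<sigma> (ks (Suc n)) \<noteq> \<sigma> (ks (Suc n) - 1)"
      unfolding img by simp
    moreover have "\<sigma> (ks (Suc n) - 1) = \<sigma> (ks n)"
      using lt by (intro switching_sequence_const[OF ks]) auto
    ultimately show ?thesis by simp
  qed
  have "ks (j * L + l) - ks (j * L + l - 1) \<in> {\<tau>min..\<tau>max}" if "l \<in> {1..L}" for l
    using dwell[of "j * L + l - 1"] that by (cases l) auto
  moreover have "\<sigma> (ks (j * L + l - 1)) \<noteq> \<sigma> (ks (j * L + l))" if "1 \<le> l" for l
    using change[of "j * L + l - 1"] that by (cases l) auto
  ultimately show ?thesis
    using sw by (auto simp: switching_cycles_def index_seqs_def signal_cycle_def switching_signal_def
        simp del: atLeastAtMost_iff) (auto)
qed

lemma sum_actime_signal_cycle: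
  assumes "strict_mono ks" "l \<le> L"
  shows "(\<Sum>s = 1..l. actime (signal_cycle \<sigma> ks L j) s) = ks (j * L + l) - ks (j * L)"
  using assms(2)
proof (induction l)
  case (Suc l)
  have "ks (j * L) \<le> ks (j * L + l)" "ks (j * L + l) \<le> ks (Suc (j * L + l))"
    using assms(1) by (simp_all add: strict_mono_less_eq)
  then show ?case
    using Suc by (simp add: signal_cycle_def)
qed simp

lemma solution_shift:
  "solution A \<sigma> x0 (m + k) = transition (\<lambda>k. A (\<sigma> (m + k))) k *v solution A \<sigma> x0 m"
  by (induction k) (simp_all add: matrix_vector_mul_assoc)

lemma solution_signal_cycle:
  assumes ks: "switching_sequence \<sigma> ks"
  shows "solution A \<sigma> x0 (ks (Suc j * L)) =
    cycle_matrix A (signal_cycle \<sigma> ks L j) L *v solution A \<sigma> x0 (ks (j * L))"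
proof -
  define m where "m = ks (j * L)"
  have mono: "strict_mono ks"
    using ks by (simp add: switching_sequence_def)
  have le: "m \<le> ks (j * L + l)" for l
    unfolding m_def using mono by (simp add: strict_mono_less_eq)
  have "transition (\<lambda>k. A (\<sigma> (m + k))) (\<Sum>s = 1..L. actime (signal_cycle \<sigma> ks L j) s)
      = cycle_matrix A (signal_cycle \<sigma> ks L j) L"
  proof (rule transition_cycle[where L = L])
    fix l k
    assume l: "l \<in> {1..L}"
      and "(\<Sum>s = 1..l - 1. actime (signal_cycle \<sigma> ks L j) s) \<le> k"
      and "k < (\<Sum>s = 1..l. actime (signal_cycle \<sigma> ks L j) s)"
    then have "ks (j * L + (l - 1)) \<le> m + k" "m + k < ks (j * L + l)"
      using sum_actime_signal_cycle[OF mono, of "l - 1" L] sum_actime_signal_cycle[OF mono, of l L]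
      by (auto simp: m_def[symmetric])
    then have "\<sigma> (m + k) = \<sigma> (ks (j * L + (l - 1)))"
      using l by (intro switching_sequence_const[OF ks]) (auto simp: Suc_diff_le)
    then show "A (\<sigma> (m + k)) = A (subsys (signal_cycle \<sigma> ks L j) l)"
      using l by (simp add: signal_cycle_def)
  qed simp
  moreover have "(\<Sum>s = 1..L. actime (signal_cycle \<sigma> ks L j) s) = ks (Suc j * L) - m"
    using sum_actime_signal_cycle[OF mono, of L L] by (simp add: m_def add.commute)
  moreover have "m \<le> ks (Suc j * L)"
    using le[of L] by (simp add: add.commute)
  ultimately show ?thesis
    using solution_shift[of A \<sigma> x0 m "ks (Suc j * L) - m"] by (simp add: m_def)
qed

section \<open>From decay at sampling times to stability\<close>

lemma class_KL_exponential:
  assumes "0 < K" "0 < \<mu>" "\<mu> < 1"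
  shows "class_KL (\<lambda>r s. K * r * \<mu> powr s)"
  unfolding class_KL_def
proof (intro conjI allI impI)
  fix s :: real
  show "class_K (\<lambda>r. K * r * \<mu> powr s)"
    unfolding class_K_def using assms
    by (auto intro!: continuous_intros strict_mono_onI)
next
  fix r :: real assume r: "0 \<le> r"
  show "antimono_on {0..} (\<lambda>s. K * r * \<mu> powr s)"
    using assms r by (auto intro!: monotone_onI mult_left_mono powr_mono')
  have "((\<lambda>s. \<mu> powr s) \<longlongrightarrow> 0) at_top"
    using assms by real_asymp
  then show "((\<lambda>s. K * r * \<mu> powr s) \<longlongrightarrow> 0) at_top"
    by (rule tendsto_mult_right_zero)
qed

lemma interval_of_strict_mono:
  fixes t :: "nat \<Rightarrow> nat"
  assumes "strict_mono t" "t 0 = 0"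
  shows "\<exists>j. t j \<le> k \<and> k < t (Suc j)"
proof (induction k)
  case 0
  show ?case
    using assms strict_monoD[OF assms(1), of 0 "Suc 0"] by (intro exI[of _ 0]) auto
next
  case (Suc k)
  then obtain j where j: "t j \<le> k" "k < t (Suc j)" by blast
  show ?case
  proof (cases "Suc k < t (Suc j)")
    case True
    with j show ?thesis by (intro exI[of _ j]) auto
  next
    case False
    with j strict_monoD[OF assms(1), of "Suc j" "Suc (Suc j)"] show ?thesis
      by (intro exI[of _ "Suc j"]) auto
  qed
qed

lemma solution_growth:
  assumes "\<And>k v. norm (A (\<sigma> k) *v v) \<le> G * norm v" "0 \<le> G"
  shows "norm (solution A \<sigma> x0 (m + k)) \<le> G ^ k * norm (solution A \<sigma> x0 m)"
proof (induction k)
  case (Suc k)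
  have "norm (solution A \<sigma> x0 (m + Suc k)) \<le> G * norm (solution A \<sigma> x0 (m + k))"
    using assms(1) by simp
  also have "\<dots> \<le> G * (G ^ k * norm (solution A \<sigma> x0 m))"
    using Suc assms(2) by (rule mult_left_mono)
  finally show ?case by simp
qed simp

text \<open>Decay at sampling times with bounded gaps controls the solution at all times: between two
  samples it grows at most by \<open>G\<^sup>D\<close>, and at time \<open>k\<close> at least \<open>k / D - 1\<close> sampling periods have
  passed.\<close>

lemma GUAS_of_sampled_decay:
  fixes A :: "nat \<Rightarrow> real^'n^'n"
  assumes t: "strict_mono t" "t 0 = 0" "\<And>j. t (Suc j) \<le> t j + D"
    and growth: "\<And>k v. norm (A (\<sigma> k) *v v) \<le> G * norm v" "1 \<le> G"
    and decay: "\<And>x0 j. norm (solution A \<sigma> x0 (t j)) \<le> C * \<rho> ^ j * norm x0"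
    and "0 < C" "0 < \<rho>" "\<rho> < 1"
  shows "GUAS A \<sigma>"
  unfolding GUAS_def
proof (intro allI)
  fix x0 :: "real^'n"
  \<comment> \<open>The factor \<open>1 / \<rho>\<close> accounts for the sampling period that is still running at time \<open>k\<close>.\<close>
  define K where "K = G ^ D * C / \<rho>"
  define \<mu> where "\<mu> = \<rho> powr (1 / real D)"
  have D: "D > 0"
    using t(3)[of 0] t(2) strict_monoD[OF t(1), of 0 1] by auto
  have t_le: "t j \<le> j * D" for j
  proof (induction j)
    case (Suc j)
    then show ?case using t(3)[of j] by simp
  qed (simp add: t(2))
  have \<mu>: "0 < \<mu>" "\<mu> < 1"
    using assms(7-9) D by (auto simp: \<mu>_def powr_less_mono2[of "1 / real D" \<rho> 1, simplified])
  have "norm (solution A \<sigma> x0 k) \<le> K * norm x0 * \<mu> powr real k" for k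
  proof -
    obtain j where j: "t j \<le> k" "k < t (Suc j)"
      using interval_of_strict_mono[OF t(1,2)] by blast
    have "norm (solution A \<sigma> x0 k) \<le> G ^ (k - t j) * norm (solution A \<sigma> x0 (t j))"
      using solution_growth[of A \<sigma> G x0 "t j" "k - t j"] growth j by simp
    also have "\<dots> \<le> G ^ D * (C * \<rho> ^ j * norm x0)"
      using growth(2) j t(3)[of j] decay by (intro mult_mono power_increasing) auto
    also have "\<rho> ^ j = \<rho> powr real (Suc j) / \<rho>"
      using assms(8) by (subst powr_realpow) auto
    also have "G ^ D * (C * (\<rho> powr real (Suc j) / \<rho>) * norm x0) = K * norm x0 * \<rho> powr real (Suc j)"
      by (simp add: K_def)
    also have "\<dots> \<le> K * norm x0 * \<rho> powr (real k / real D)"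
    proof (intro mult_left_mono powr_mono')
      have "real k \<le> real (Suc j * D)"
        using j(2) t_le[of "Suc j"] by (intro of_nat_mono) linarith
      then show "real k / real D \<le> real (Suc j)"
        using D by (simp add: field_simps)
    qed (use assms(7-9) growth(2) in \<open>auto simp: K_def\<close>)
    also have "\<rho> powr (real k / real D) = \<mu> powr real k"
      by (simp add: \<mu>_def powr_powr)
    finally show ?thesis .
  qed
  moreover have "class_KL (\<lambda>r s. K * r * \<mu> powr s)"
    using \<mu> assms(7,8) growth(2) by (intro class_KL_exponential) (auto simp: K_def)
  ultimately show "\<exists>\<beta>. class_KL \<beta> \<and> (\<forall>k. norm (solution A \<sigma> x0 k) \<le> \<beta> (norm x0) (real k))"
    by (intro exI[of _ "\<lambda>r s. K * r * \<mu> powr s"]) simp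
qed

lemma common_growth_bound:
  fixes A :: "nat \<Rightarrow> real^'n^'n"
  shows "\<exists>G\<ge>1. \<forall>i\<in>{1..N}. \<forall>v. norm (A i *v v) \<le> G * norm v"
proof -
  define G where "G = 1 + (\<Sum>i = 1..N. onorm ((*v) (A i)))"
  have nn: "0 \<le> onorm ((*v) (A i))" for i
    by (simp add: onorm_pos_le matrix_vector_mul_bounded_linear)
  have "norm (A i *v v) \<le> G * norm v" if "i \<in> {1..N}" for i v
  proof -
    have "norm (A i *v v) \<le> onorm ((*v) (A i)) * norm v"
      by (rule onorm[OF matrix_vector_mul_bounded_linear])
    also have "onorm ((*v) (A i)) \<le> G"
      using member_le_sum[of i "{1..N}" "\<lambda>i. onorm ((*v) (A i))"] that nn by (auto simp: G_def)
    finally show ?thesis by (simp add: mult_right_mono)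
  qed
  moreover have "1 \<le> G"
    using nn by (simp add: G_def sum_nonneg)
  ultimately show ?thesis by blast
qed

section \<open>Stability from the lifted inequalities\<close>

text \<open>The constants of the decay estimate. A strict inequality between quadratic forms of the cycles
  is a contraction by some factor below \<open>1\<close>, and there are finitely many of them; the same small
  \<open>e\<close> compares all forms with the squared norm.\<close>

lemma lifted_condition_contraction:
  fixes A :: "nat \<Rightarrow> real^'n^'n"
  assumes "lifted_condition A L M cyc"
  obtains P :: "nat \<Rightarrow> real^'n^'n" and e :: real
    where "0 < e" "e < 1"
      and "\<And>q v. q \<in> {1..M} \<Longrightarrow> e * (norm v)\<^sup>2 \<le> quad (P q) v"
      and "\<And>q v. q \<in> {1..M} \<Longrightarrow> e * quad (P q) v \<le> (norm v)\<^sup>2"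
      and "\<And>h q v. h \<in> {1..M} \<Longrightarrow> q \<in> {1..M} \<Longrightarrow>
             quad (P h) (cycle_matrix A (cyc h) L *v v) \<le> (1 - e) * quad (P q) v"
proof -
  define F where "F h = cycle_matrix A (cyc h) L" for h
  obtain P :: "nat \<Rightarrow> real^'n^'n" where pd: "\<And>h. h \<in> {1..M} \<Longrightarrow> pos_def (P h)"
    and step: "\<And>h q. h \<in> {1..M} \<Longrightarrow> q \<in> {1..M} \<Longrightarrow> transpose (F h) ** P h ** F h - P q \<prec> 0"
    using assms unfolding lifted_condition_def F_def by blast
  have "\<forall>\<^sub>F e in at_right 0. \<forall>q\<in>{1..M}. pos_def (P q - e *\<^sub>R mat 1)"
    using pd by (intro eventually_ball_finite ballI pos_def_perturb) (auto simp: transpose_mat)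
  moreover have "\<forall>\<^sub>F e in at_right 0. \<forall>q\<in>{1..M}. pos_def (mat 1 - e *\<^sub>R P q)"
    using pd by (intro eventually_ball_finite ballI pos_def_perturb) (auto simp: pos_def_mat_1 pos_def_sym)
  moreover have "\<forall>\<^sub>F e in at_right 0. \<forall>h\<in>{1..M}. \<forall>q\<in>{1..M}.
      pos_def (P q - transpose (F h) ** P h ** F h - e *\<^sub>R P q)"
    using pd step by (intro eventually_ball_finite ballI pos_def_perturb) (auto simp: prec_def pos_def_sym)
  moreover have "\<forall>\<^sub>F e in at_right (0::real). 0 < e \<and> e < 1"
    unfolding eventually_at_right_field by (intro exI[of _ 1]) auto
  ultimately have "\<forall>\<^sub>F e in at_right 0. (0 < e \<and> e < 1) \<and>
      (\<forall>q\<in>{1..M}. pos_def (P q - e *\<^sub>R mat 1)) \<and> (\<forall>q\<in>{1..M}. pos_def (mat 1 - e *\<^sub>R P q)) \<and>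
      (\<forall>h\<in>{1..M}. \<forall>q\<in>{1..M}. pos_def (P q - transpose (F h) ** P h ** F h - e *\<^sub>R P q))"
    by eventually_elim blast
  then obtain e :: real where e: "0 < e" "e < 1"
    and 1: "\<And>q. q \<in> {1..M} \<Longrightarrow> pos_def (P q - e *\<^sub>R mat 1)"
    and 2: "\<And>q. q \<in> {1..M} \<Longrightarrow> pos_def (mat 1 - e *\<^sub>R P q)"
    and 3: "\<And>h q. h \<in> {1..M} \<Longrightarrow> q \<in> {1..M} \<Longrightarrow>
        pos_def (P q - transpose (F h) ** P h ** F h - e *\<^sub>R P q)"
    using eventually_happens'[OF trivial_limit_at_right_real] by blast
  show thesis
  proof (rule that[OF e])
    show "e * (norm v)\<^sup>2 \<le> quad (P q) v" if "q \<in> {1..M}" for q v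
      using quad_nonneg[OF 1[OF that], of v] by (simp add: quad_diff quad_scaleR quad_one)
    show "e * quad (P q) v \<le> (norm v)\<^sup>2" if "q \<in> {1..M}" for q v
      using quad_nonneg[OF 2[OF that], of v] by (simp add: quad_diff quad_scaleR quad_one)
    show "quad (P h) (cycle_matrix A (cyc h) L *v v) \<le> (1 - e) * quad (P q) v"
      if "h \<in> {1..M}" "q \<in> {1..M}" for h q v
      using quad_nonneg[OF 3[OF that], of v]
      by (simp add: quad_diff quad_scaleR quad_congruence F_def left_diff_distrib)
  qed
qed

text \<open>At the group boundaries the squared norm decays like \<open>(1 - e)\<^sup>j\<close>; comparing with the form
  loses one factor \<open>1 / e\<close> at the start and one at the end, hence the constant \<open>1 / e\<close> for
  the norm itself.\<close>

lemma lifted_condition_GUAS: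
  fixes A :: "nat \<Rightarrow> real^'n^'n"
  assumes "1 \<le> L"
    and cyc: "bij_betw cyc {1..M} (switching_cycles N \<tau>min \<tau>max L)"
    and lifted: "lifted_condition A L M cyc"
    and \<sigma>: "\<sigma> \<in> dwell_signals N \<tau>min \<tau>max"
  shows "GUAS A \<sigma>"
proof -
  obtain ks where sw: "switching_signal N \<sigma>" and ks: "switching_sequence \<sigma> ks"
    and dwell: "\<And>n. ks (Suc n) - ks n \<in> {\<tau>min..\<tau>max}"
    using \<sigma> unfolding dwell_signals_def by blast
  have mono: "strict_mono ks" and ks0: "ks 0 = 0"
    using ks by (auto simp: switching_sequence_def)
  obtain P e where e: "0 < e" "e < 1"
    and lower: "\<And>q v. q \<in> {1..M} \<Longrightarrow> e * (norm v)\<^sup>2 \<le> quad (P q) v"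
    and upper: "\<And>q v. q \<in> {1..M} \<Longrightarrow> e * quad (P q) v \<le> (norm v)\<^sup>2"
    and contr: "\<And>h q v. h \<in> {1..M} \<Longrightarrow> q \<in> {1..M} \<Longrightarrow>
        quad (P h) (cycle_matrix A (cyc h) L *v v) \<le> (1 - e) * quad (P q) v"
    using lifted_condition_contraction[OF lifted] by metis
  have cycle: "\<exists>h\<in>{1..M}. cyc h = signal_cycle \<sigma> ks L j" for j
    using signal_cycle_mem[OF sw ks dwell, of L j] cyc unfolding bij_betw_def by (metis imageE)
  obtain G where G: "1 \<le> G" "\<And>i v. i \<in> {1..N} \<Longrightarrow> norm (A i *v v) \<le> G * norm v"
    using common_growth_bound by metis
  define t where "t j = ks (j * L)" for j
  have "norm (solution A \<sigma> x0 (t j)) \<le> 1 / e * sqrt (1 - e) ^ j * norm x0" for x0 j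
  proof -
    define y where "y j = solution A \<sigma> x0 (t j)" for j
    \<comment> \<open>The form that certifies the decay is the one of the cycle just completed, so it depends
      on \<open>j\<close>. Only at time \<open>0\<close> is the choice free; the form of the first cycle serves there.\<close>
    have "\<exists>q\<in>{1..M}. e * quad (P q) (y j) \<le> (1 - e) ^ j * (norm x0)\<^sup>2"
    proof (induction j)
      case 0
      then show ?case
        using cycle[of 0] upper[of _ x0] by (auto simp: y_def t_def ks0)
    next
      case (Suc j)
      then obtain q where q: "q \<in> {1..M}" "e * quad (P q) (y j) \<le> (1 - e) ^ j * (norm x0)\<^sup>2"
        by blast
      obtain h where h: "h \<in> {1..M}" "cyc h = signal_cycle \<sigma> ks L j"
        using cycle by blast
      have "y (Suc j) = cycle_matrix A (cyc h) L *v y j"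
        unfolding y_def t_def h(2) by (rule solution_signal_cycle[OF ks])
      then have "e * quad (P h) (y (Suc j)) \<le> e * ((1 - e) * quad (P q) (y j))"
        using contr[OF h(1) q(1)] e by simp
      also have "\<dots> \<le> (1 - e) * ((1 - e) ^ j * (norm x0)\<^sup>2)"
        using mult_left_mono[OF q(2), of "1 - e"] e by (simp add: mult.left_commute)
      finally show ?case
        using h(1) by (auto simp: mult.assoc)
    qed
    then obtain q where q: "q \<in> {1..M}" "e * quad (P q) (y j) \<le> (1 - e) ^ j * (norm x0)\<^sup>2"
      by blast
    have sq: "(sqrt (1 - e) ^ j)\<^sup>2 = (1 - e) ^ j"
      using e by (simp add: power_commuting_commutes power2_eq_square flip: power_mult_distrib)
    have "e * (e * (norm (y j))\<^sup>2) \<le> (1 - e) ^ j * (norm x0)\<^sup>2"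
      using order_trans[OF mult_left_mono[OF lower[OF q(1), of "y j"], of e] q(2)] e by simp
    with sq have "(e * norm (y j))\<^sup>2 \<le> (sqrt (1 - e) ^ j * norm x0)\<^sup>2"
      using e by (simp add: power_mult_distrib power2_eq_square[of e] mult.assoc)
    then have "e * norm (y j) \<le> sqrt (1 - e) ^ j * norm x0"
      using e by (intro power2_le_imp_le[of "e * norm (y j)"]) auto
    then show ?thesis
      using e by (simp add: y_def field_simps)
  qed
  moreover have "t (Suc j) \<le> t j + L * \<tau>max" for j
  proof -
    have "ks (j * L + l) \<le> t j + l * \<tau>max" for l
    proof (induction l)
      case (Suc l)
      then show ?case
        using dwell[of "j * L + l"] by auto
    qed (simp add: t_def)
    from this[of L] show ?thesis
      by (simp add: t_def add.commute)
  qed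
  moreover have "strict_mono t"
    using mono assms(1) by (auto simp: t_def strict_mono_def)
  moreover have "norm (A (\<sigma> k) *v v) \<le> G * norm v" for k v
    using G(2) sw by (simp add: switching_signal_def)
  ultimately show ?thesis
    using e G(1) by (intro GUAS_of_sampled_decay[where t = t and D = "L * \<tau>max" and G = G
          and C = "1 / e" and \<rho> = "sqrt (1 - e)"]) (auto simp: t_def ks0)
qed

theorem theorem1:
  fixes A :: "nat \<Rightarrow> real^'n^'n"
    and N \<tau>min \<tau>max L M :: nat
    and cyc :: "nat \<Rightarrow> cycle"
  assumes "1 \<le> N"
    and "1 \<le> \<tau>min" and "\<tau>min \<le> \<tau>max"
    and "1 \<le> L"
    and "M = num_cycles N \<tau>min \<tau>max L"
    and "bij_betw cyc {1..M} (switching_cycles N \<tau>min \<tau>max L)"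
  shows "(sequence_condition A L M cyc \<longleftrightarrow> lifted_condition A L M cyc) \<and>
    (sequence_condition A L M cyc \<or> lifted_condition A L M cyc \<longrightarrow>
      (\<forall>\<sigma>\<in>dwell_signals N \<tau>min \<tau>max. GUAS A \<sigma>))"
  using sequence_condition_imp_lifted lifted_condition_imp_sequence
    lifted_condition_GUAS[OF assms(4,6)] by blast

end
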